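(* Let $\Lambda$ be a lattice in $\mathbb{R}^2$, let $s(\Lambda)$ be the length of the shortest non-zero vector of $\Lambda$, and let $0<\epsilon<s(\Lambda)/2$. Then there is a perfect set $\Theta\subseteq S^1$ which is not $(\Lambda,\epsilon)$-good.
   Context: A lattice in $\mathbb{R}^2$ is a discrete subgroup of $\mathbb{R}^2$ of rank 2. A perfect set is a nonempty closed set with no isolated points. $B_\epsilon(0)=\{x\in\mathbb{R}^2:|x|<\epsilon\}$. $S^1$ is the unit circle, identified with the set of angles (mod $2\pi$). $R_\theta$ denotes rotation of $\mathbb{R}^2$ about the origin by the angle $\theta$, and $R_\Theta E = \{R_\theta x: \theta\in\Theta, x\in E\}$. A set $\Theta\subseteq S^1$ is called $(\Lambda,\epsilon)$-good if $R_\Theta E$ contains the complement of a disk, where $E=\Lambda+B_\epsilon(0)$. *)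

theory Defs
  imports "HOL-Analysis.Analysis"
begin

definition additive_subgroup :: "'a::ab_group_add set \<Rightarrow> bool" where
  "additive_subgroup A \<longleftrightarrow>
     0 \<in> A \<and> (\<forall>x\<in>A. \<forall>y\<in>A. x + y \<in> A) \<and> (\<forall>x\<in>A. - x \<in> A)"

abbreviation int_scale :: "int \<Rightarrow> 'a::real_vector \<Rightarrow> 'a" where
  "int_scale k x \<equiv> real_of_int k *\<^sub>R x"

lemma module_int_scale: "module (int_scale :: int \<Rightarrow> 'a::real_vector \<Rightarrow> 'a)"
  by unfold_locales (simp_all add: algebra_simps)

text \<open>The rank of an additive subgroup is its rank as an abelian group: the largest number of
  elements that are linearly independent over the integers (not over the reals).\<close>

definition has_int_rank :: "'a::real_vector set \<Rightarrow> nat \<Rightarrow> bool" where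
  "has_int_rank A r \<longleftrightarrow>
     (\<exists>B\<subseteq>A. finite B \<and> \<not> module.dependent int_scale B \<and> card B = r) \<and>
     (\<forall>B\<subseteq>A. finite B \<and> \<not> module.dependent int_scale B \<longrightarrow> card B \<le> r)"

definition plane_lattice :: "(real^2) set \<Rightarrow> bool" where
  "plane_lattice L \<longleftrightarrow> additive_subgroup L \<and> discrete L \<and> has_int_rank L 2"

text \<open>For a lattice the infimum below is attained, since bounded sets contain only finitely many
  lattice vectors.\<close>

definition shortest_length :: "(real^2) set \<Rightarrow> real" where
  "shortest_length L = (INF v\<in>L - {0}. norm v)"

definition perfect_set :: "'a::topological_space set \<Rightarrow> bool" where
  "perfect_set S \<longleftrightarrow> S \<noteq> {} \<and> closed S \<and> (\<forall>x\<in>S. \<not> x isolated_in S)"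

abbreviation unit_circle :: "(real^2) set" where
  "unit_circle \<equiv> sphere 0 1"

definition circle_point :: "real \<Rightarrow> real^2" where
  "circle_point t = vector [cos t, sin t]"

definition rotation :: "real \<Rightarrow> real^2 \<Rightarrow> real^2" where
  "rotation t x = vector [cos t * x $ 1 - sin t * x $ 2, sin t * x $ 1 + cos t * x $ 2]"

text \<open>A set of angles modulo \<open>2 * pi\<close> is given as a subset \<open>T\<close> of the unit circle; the real numbers
  \<open>t\<close> with \<open>circle_point t \<in> T\<close> are all representatives of its members.\<close>

definition rotate_set :: "(real^2) set \<Rightarrow> (real^2) set \<Rightarrow> (real^2) set" where
  "rotate_set T E = {rotation t x | t x. circle_point t \<in> T \<and> x \<in> E}"

text \<open>The sum of two sets is the Minkowski sum.\<close>

definition good :: "(real^2) set \<Rightarrow> real \<Rightarrow> (real^2) set \<Rightarrow> bool" where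
  "good L e T \<longleftrightarrow> (\<exists>c r. r > 0 \<and> - ball c r \<subseteq> rotate_set T (L + ball 0 e))"

end

theory Submission
  imports Defs
begin

text \<open>Distinct lattice points are at distance at least \<open>s(\<Lambda>)\<close>, so the balls of radius
  \<open>s(\<Lambda>) / 2\<close> around them are disjoint, and a connected set of diameter at least \<open>s(\<Lambda>)\<close> must
  leave their union. A fixed arc of directions, at large radius \<open>k\<close>, therefore contains a point
  outside all of these balls, and a whole subarc outside \<open>E\<close> because \<open>\<epsilon> < s(\<Lambda>) / 2\<close>.
  Choosing two such subarcs in each of finitely many arcs simultaneously, for larger and larger
  \<open>k\<close>, is a Cantor construction. Its limit \<open>\<Theta>\<close> is perfect, and \<open>R\<^sub>\<Theta> E\<close> misses
  \<open>(k, 0)\<close> for infinitely many \<open>k\<close>.\<close>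

section \<open>Cantor construction inside a family of sets of angles\<close>

text \<open>Each stage replaces every interval of a finite family by two disjoint shorter ones
  inside a common \<open>A k\<close>. Since the hypothesis holds for all large \<open>k\<close>,
  finitely many instances share one \<open>k\<close>; each stage contributes one such
  \<open>k\<close>, whence \<open>frequently\<close> in the conclusion.\<close>

lemma perfect_subset_frequently:
  fixes u v :: real and A :: "nat \<Rightarrow> real set"
  assumes "u < v"
    and A: "\<And>a b. u \<le> a \<Longrightarrow> a < b \<Longrightarrow> b \<le> v \<Longrightarrow>
      \<forall>\<^sub>F k in sequentially. \<exists>c d. a \<le> c \<and> c < d \<and> d \<le> b \<and> {c..d} \<subseteq> A k"
  shows "\<exists>P \<subseteq> {u..v}. perfect_set P \<and> (\<exists>\<^sub>F k in sequentially. P \<subseteq> A k)"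
proof -
  define J :: "real \<times> real \<Rightarrow> real set" where "J p = {fst p..snd p}" for p
  define inv where "inv n F \<longleftrightarrow> finite F \<and> F \<noteq> {} \<and>
    (\<forall>p\<in>F. u \<le> fst p \<and> fst p < snd p \<and> snd p \<le> v \<and> snd p - fst p \<le> (v - u) / 2 ^ n)"
    for n and F :: "(real \<times> real) set"
  \<comment> \<open>The three conjuncts serve in turn for \<open>P \<subseteq> A k\<close> at
    arbitrarily large \<open>k\<close>, for nestedness of the stages, and for the absence of
    isolated points.\<close>
  define step where "step n F F' \<longleftrightarrow>
    (\<exists>k\<ge>n. \<forall>q\<in>F'. J q \<subseteq> A k) \<and> (\<forall>q\<in>F'. \<exists>p\<in>F. J q \<subseteq> J p) \<and>
    (\<forall>p\<in>F. \<exists>q\<in>F'. \<exists>r\<in>F'. J q \<subseteq> J p \<and> J r \<subseteq> J p \<and> J q \<inter> J r = {})"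
    for n :: nat and F F' :: "(real \<times> real) set"
  have "\<exists>F. \<forall>n. inv n (F n) \<and> step n (F n) (F (Suc n))"
  proof (rule dependent_nat_choice)
    show "\<exists>F. inv 0 F"
      using \<open>u < v\<close> by (intro exI[of _ "{(u, v)}"]) (simp add: inv_def)
  next
    fix F n assume F: "inv n F"
    let ?Q = "\<lambda>a b k q. a \<le> fst q \<and> fst q < snd q \<and> snd q \<le> b \<and> J q \<subseteq> A k"
    \<comment> \<open>Replacements are sought in the outer thirds: the middle third keeps them
      disjoint, and a third of the length is below the half demanded by
      \<open>inv (Suc n)\<close>.\<close>
    let ?l = "\<lambda>p. fst p + (snd p - fst p) / 3" and ?r = "\<lambda>p. snd p - (snd p - fst p) / 3"
    have "\<forall>p\<in>F. \<forall>\<^sub>F k in sequentially. (\<exists>q. ?Q (fst p) (?l p) k q) \<and> (\<exists>q. ?Q (?r p) (snd p) k q)"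
    proof
      fix p assume "p \<in> F"
      then have p: "u \<le> fst p" "fst p < snd p" "snd p \<le> v"
        using F by (auto simp: inv_def)
      have "\<forall>\<^sub>F k in sequentially. \<exists>c d. fst p \<le> c \<and> c < d \<and> d \<le> ?l p \<and> {c..d} \<subseteq> A k"
        using p by (intro A) (auto simp: field_simps)
      moreover have "\<forall>\<^sub>F k in sequentially. \<exists>c d. ?r p \<le> c \<and> c < d \<and> d \<le> snd p \<and> {c..d} \<subseteq> A k"
        using p by (intro A) (auto simp: field_simps)
      ultimately show "\<forall>\<^sub>F k in sequentially. (\<exists>q. ?Q (fst p) (?l p) k q) \<and> (\<exists>q. ?Q (?r p) (snd p) k q)"
        by eventually_elim (simp add: J_def)
    qed
    \<comment> \<open>Finiteness of \<open>F\<close> makes the threshold for \<open>k\<close>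
      uniform over all its intervals.\<close>
    then have "\<forall>\<^sub>F k in sequentially. \<forall>p\<in>F. (\<exists>q. ?Q (fst p) (?l p) k q) \<and> (\<exists>q. ?Q (?r p) (snd p) k q)"
      using F by (intro eventually_ball_finite) (auto simp: inv_def)
    from eventually_happens'[OF sequentially_bot eventually_conj[OF eventually_ge_at_top[of n] this]]
    obtain k where "k \<ge> n"
      and k: "\<forall>p\<in>F. (\<exists>q. ?Q (fst p) (?l p) k q) \<and> (\<exists>q. ?Q (?r p) (snd p) k q)"
      by blast
    from k obtain f where f: "\<forall>p\<in>F. ?Q (fst p) (?l p) k (f p)"
      using bchoice[of F "\<lambda>p q. ?Q (fst p) (?l p) k q"] by blast
    from k obtain g where g: "\<forall>p\<in>F. ?Q (?r p) (snd p) k (g p)"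
      using bchoice[of F "\<lambda>p q. ?Q (?r p) (snd p) k q"] by blast
    have fg: "J (f p) \<subseteq> J p" "J (g p) \<subseteq> J p" "J (f p) \<inter> J (g p) = {}"
      "J (f p) \<subseteq> A k" "J (g p) \<subseteq> A k"
      "u \<le> fst (f p) \<and> fst (f p) < snd (f p) \<and> snd (f p) \<le> v
        \<and> snd (f p) - fst (f p) \<le> (v - u) / 2 ^ Suc n"
      "u \<le> fst (g p) \<and> fst (g p) < snd (g p) \<and> snd (g p) \<le> v
        \<and> snd (g p) - fst (g p) \<le> (v - u) / 2 ^ Suc n"
      if "p \<in> F" for p
    proof -
      define w where "w = (v - u) / 2 ^ n"
      have p: "u \<le> fst p" "fst p < snd p" "snd p \<le> v" "snd p - fst p \<le> w"
        using F that by (auto simp: inv_def w_def)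
      have h: "(v - u) / 2 ^ Suc n = w / 2"
        by (simp add: w_def)
      have q: "?Q (fst p) (?l p) k (f p)" "?Q (?r p) (snd p) k (g p)"
        using f g that by auto
      then show "J (f p) \<subseteq> A k" "J (g p) \<subseteq> A k"
        by auto
      show "J (f p) \<subseteq> J p" "J (g p) \<subseteq> J p" "J (f p) \<inter> J (g p) = {}"
        using p q by (auto simp: J_def field_simps)
      show "u \<le> fst (f p) \<and> fst (f p) < snd (f p) \<and> snd (f p) \<le> v
        \<and> snd (f p) - fst (f p) \<le> (v - u) / 2 ^ Suc n"
        using p q unfolding h by (auto simp: field_simps)
      show "u \<le> fst (g p) \<and> fst (g p) < snd (g p) \<and> snd (g p) \<le> v
        \<and> snd (g p) - fst (g p) \<le> (v - u) / 2 ^ Suc n"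
        using p q unfolding h by (auto simp: field_simps)
    qed
    have "inv (Suc n) (f ` F \<union> g ` F)"
      unfolding inv_def using F fg(6,7) by (auto simp: inv_def)
    moreover have "step n F (f ` F \<union> g ` F)"
      unfolding step_def
    proof (intro conjI)
      show "\<exists>k\<ge>n. \<forall>q\<in>f ` F \<union> g ` F. J q \<subseteq> A k"
        using \<open>k \<ge> n\<close> fg(4,5) by blast
      show "\<forall>q\<in>f ` F \<union> g ` F. \<exists>p\<in>F. J q \<subseteq> J p"
        using fg(1,2) by blast
      show "\<forall>p\<in>F. \<exists>q\<in>f ` F \<union> g ` F. \<exists>r\<in>f ` F \<union> g ` F. J q \<subseteq> J p \<and> J r \<subseteq> J p \<and> J q \<inter> J r = {}"
        using fg(1,2,3) by blast
    qed
    ultimately show "\<exists>F'. inv (Suc n) F' \<and> step n F F'"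
      by blast
  qed
  then obtain F where inv: "\<And>n. inv n (F n)" and step: "\<And>n. step n (F n) (F (Suc n))"
    by blast
  define K where "K n = (\<Union>p\<in>F n. J p)" for n
  define P where "P = (\<Inter>n. K n)"
  have compact_K: "compact (K n)" for n
    unfolding K_def using inv[of n] by (intro compact_UN) (auto simp: inv_def J_def)
  have "K (Suc n) \<subseteq> K n" for n
    using step[of n] unfolding K_def step_def by blast
  then have K_mono: "K n \<subseteq> K m" if "m \<le> n" for m n
    using that by (rule lift_Suc_antimono_le)
  have desc: "\<exists>q\<in>F (n + m). J q \<subseteq> J p" if "p \<in> F n" for p n m
  proof (induction m)
    case 0
    then show ?case using that by auto
  next
    case (Suc m)
    then obtain q where "q \<in> F (n + m)" "J q \<subseteq> J p" by blast
    then show ?case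
      using step[of "n + m"] unfolding step_def by fastforce
  qed
  \<comment> \<open>Every interval of every stage contains a point of \<open>P\<close>: by
    \<open>desc\<close> the nested compact sets \<open>J p \<inter> K (n + m)\<close> are nonempty,
    so they have a common point.\<close>
  have meets: "P \<inter> J p \<noteq> {}" if "p \<in> F n" for p n
  proof -
    have "(\<Inter>m. J p \<inter> K (n + m)) \<noteq> {}"
    proof (rule compact_nest)
      show "compact (J p \<inter> K (n + m))" for m
        using compact_K by (auto simp: J_def intro: compact_Int)
      show "J p \<inter> K (n + m) \<noteq> {}" for m
      proof -
        obtain q where "q \<in> F (n + m)" "J q \<subseteq> J p"
          using desc[OF \<open>p \<in> F n\<close>] by blast
        moreover from this(1) have "J q \<noteq> {}"
          using inv[of "n + m"] by (fastforce simp: inv_def J_def)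
        ultimately show ?thesis
          unfolding K_def by blast
      qed
      show "J p \<inter> K (n + m') \<subseteq> J p \<inter> K (n + m)" if "m \<le> m'" for m m'
        using K_mono[of "n + m" "n + m'"] that by auto
    qed
    then obtain x where x: "x \<in> J p" "\<And>m. x \<in> K (n + m)" by blast
    have "x \<in> K m" for m
      using x(2)[of m] K_mono[of m "n + m"] by auto
    then show ?thesis
      using x(1) by (auto simp: P_def)
  qed
  have "P \<subseteq> K 0"
    by (auto simp: P_def)
  also have "K 0 \<subseteq> {u..v}"
    using inv[of 0] by (fastforce simp: K_def J_def inv_def)
  finally have "P \<subseteq> {u..v}" .
  moreover have "\<exists>\<^sub>F k in sequentially. P \<subseteq> A k"
    unfolding frequently_sequentially
  proof
    fix n
    obtain k where "k \<ge> n" "\<forall>q\<in>F (Suc n). J q \<subseteq> A k"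
      using step[of n] unfolding step_def by blast
    moreover have "P \<subseteq> K (Suc n)"
      by (auto simp: P_def)
    ultimately show "\<exists>k\<ge>n. P \<subseteq> A k"
      unfolding K_def by blast
  qed
  moreover have "perfect_set P"
    unfolding perfect_set_def
  proof (intro conjI ballI)
    show "P \<noteq> {}"
      using meets[of _ 0] inv[of 0] by (auto simp: inv_def)
    show "closed P"
      unfolding P_def using compact_K by (intro closed_INT) (simp add: compact_imp_closed)
  next
    fix x assume "x \<in> P"
    \<comment> \<open>A stage-\<open>n\<close> interval around \<open>x\<close> has two disjoint
      descendants, both meeting \<open>P\<close>, and \<open>x\<close> lies in at most one. The
      other supplies a point of \<open>P\<close> different from \<open>x\<close>, at distance at
      most the interval length, which is below \<open>e\<close> for large \<open>n\<close>.\<close>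
    have "x islimpt P"
      unfolding islimpt_approachable
    proof (intro allI impI)
      fix e :: real assume "e > 0"
      obtain n where n: "(v - u) / e < 2 ^ n"
        using real_arch_pow[of 2] by auto
      obtain p where p: "p \<in> F n" "x \<in> J p"
        using \<open>x \<in> P\<close> unfolding P_def K_def by blast
      obtain q r where "q \<in> F (Suc n)" "r \<in> F (Suc n)"
        and qr: "J q \<subseteq> J p" "J r \<subseteq> J p" "J q \<inter> J r = {}"
        using step[of n] p(1) unfolding step_def by blast
      then obtain y z where "y \<in> P \<inter> J q" "z \<in> P \<inter> J r"
        using meets by blast
      then obtain w where w: "w \<in> P" "w \<in> J p" "w \<noteq> x"
        using qr by blast
      have "dist w x \<le> snd p - fst p"
        using w(2) p(2) by (auto simp: J_def dist_real_def)
      also have "\<dots> \<le> (v - u) / 2 ^ n"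
        using inv[of n] p(1) by (auto simp: inv_def)
      also have "\<dots> < e"
        using n \<open>e > 0\<close> by (simp add: field_simps)
      finally show "\<exists>w\<in>P. w \<noteq> x \<and> dist w x < e"
        using w by blast
    qed
    then show "\<not> x isolated_in P"
      by (simp add: isolated_in_islimpt_iff)
  qed
  ultimately show ?thesis
    by blast
qed

section \<open>Transfer of perfect sets from angles to the circle\<close>

text \<open>A neighbourhood isolating \<open>f x\<close> in the image pulls back to one isolating
  \<open>x\<close>, by continuity and injectivity; compactness makes the image closed.\<close>

lemma perfect_set_image:
  fixes f :: "'a::metric_space \<Rightarrow> 'b::metric_space"
  assumes "perfect_set P" "compact P" "continuous_on P f" "inj_on f P"
  shows "perfect_set (f ` P)"
  unfolding perfect_set_def
proof (intro conjI ballI)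
  show "f ` P \<noteq> {}"
    using assms(1) by (simp add: perfect_set_def)
  show "closed (f ` P)"
    using assms(2,3) by (intro compact_imp_closed compact_continuous_image)
next
  fix y assume "y \<in> f ` P"
  then obtain x where x: "x \<in> P" "y = f x" by blast
  show "\<not> y isolated_in f ` P"
  proof
    assume "y isolated_in f ` P"
    then obtain T where T: "open T" "T \<inter> f ` P = {y}"
      by (auto simp: isolated_in_def)
    obtain U where U: "open U" "U \<inter> P = f -` T \<inter> P"
      using assms(3) T(1) by (metis continuous_on_open_invariant)
    have "U \<inter> P = {x}"
      using U(2) T(2) x assms(4) by (auto simp: inj_on_def)
    then have "x isolated_in P"
      using U(1) x(1) by (auto simp: isolated_in_def)
    then show False
      using assms(1) x(1) by (auto simp: perfect_set_def)
  qed
qed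

section \<open>Separated balls around lattice points\<close>

text \<open>One ball met by \<open>S\<close> and the union of all the others are disjoint open sets
  covering \<open>S\<close>, so connectedness excludes the others.\<close>

lemma connected_subset_ball:
  assumes "connected S" "S \<subseteq> (\<Union>v\<in>L. ball v e)"
    and sep: "\<And>v w. v \<in> L \<Longrightarrow> w \<in> L \<Longrightarrow> v \<noteq> w \<Longrightarrow> 2 * e \<le> dist v w"
    and "S \<noteq> {}"
  obtains v where "v \<in> L" "S \<subseteq> ball v e"
proof -
  obtain v where v: "v \<in> L" "S \<inter> ball v e \<noteq> {}"
    using assms(2,4) by blast
  let ?B = "\<Union>w\<in>L - {v}. ball w e"
  have "ball v e \<inter> ?B = {}"
    using sep[OF v(1)] disjoint_ballI[of e e v] by (fastforce simp: field_simps)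
  moreover have "S \<subseteq> ball v e \<union> ?B"
    using assms(2) by blast
  ultimately have "S \<inter> ?B = {}"
    using connectedD[OF assms(1), of "ball v e" ?B] v(2) by blast
  then have "S \<subseteq> ball v e"
    using \<open>S \<subseteq> ball v e \<union> ?B\<close> by blast
  with v(1) that show ?thesis by blast
qed

lemma shortest_length_le_dist:
  assumes "additive_subgroup L" "v \<in> L" "w \<in> L" "v \<noteq> w"
  shows "shortest_length L \<le> dist v w"
proof -
  have "v + - w \<in> L"
    using assms unfolding additive_subgroup_def by blast
  then have "v - w \<in> L - {0}"
    using assms(4) by simp
  moreover have "bdd_below (norm ` (L - {0}))"
    by (rule bdd_belowI[of _ 0]) auto
  ultimately show ?thesis
    unfolding shortest_length_def dist_norm by (rule cINF_lower[rotated])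
qed

lemma plus_ball_eq: "L + ball 0 e = (\<Union>v\<in>L. ball v e)" for L :: "'a::real_normed_vector set"
proof (intro equalityI subsetI)
  fix x assume "x \<in> (\<Union>v\<in>L. ball v e)"
  then obtain v where "v \<in> L" "x - v \<in> ball 0 e"
    by (auto simp: dist_norm norm_minus_commute)
  then show "x \<in> L + ball 0 e"
    using set_plus_intro[of v L "x - v" "ball 0 e"] by simp
qed (auto simp: set_plus_def dist_norm intro!: bexI)

section \<open>Parametrization of the circle and rotations\<close>

text \<open>On a half circle the cosine alone determines the angle.\<close>

lemma inj_on_circle_point: "inj_on circle_point {0..pi}"
proof (rule inj_onI)
  fix s t assume "s \<in> {0..pi}" "t \<in> {0..pi}" and eq: "circle_point s = circle_point t"
  moreover from eq have "cos s = cos t"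
    unfolding circle_point_def by (metis vector_2(1))
  ultimately show "s = t"
    using cos_inj_pi by auto
qed

lemma continuous_on_circle_point: "continuous_on S circle_point"
proof -
  have "circle_point = (\<lambda>t. cos t *\<^sub>R axis 1 1 + sin t *\<^sub>R axis 2 1)"
    by (auto simp: circle_point_def vec_eq_iff forall_2 axis_def)
  then show ?thesis
    by (rule ssubst) (intro continuous_intros)
qed

lemma circle_point_in_unit_circle: "circle_point t \<in> unit_circle"
  by (simp add: circle_point_def norm_vec_def L2_set_def sum_2)

text \<open>The inverse rotation matrix is applied to both coordinate equations, using
  \<open>(sin t)\<^sup>2 + (cos t)\<^sup>2 = 1\<close>. Covering a point of the positive axis thus
  becomes a condition on the direction \<open>- t\<close>.\<close>

lemma rotation_eqD:
  assumes "rotation t x = r *\<^sub>R circle_point 0"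
  shows "x = r *\<^sub>R circle_point (- t)"
proof -
  have 1: "cos t * x $ 1 - sin t * x $ 2 = r" and 2: "sin t * x $ 1 + cos t * x $ 2 = 0"
    using assms by (simp_all add: rotation_def circle_point_def vec_eq_iff forall_2)
  have "x $ 1 = ((sin t)\<^sup>2 + (cos t)\<^sup>2) * x $ 1"
    by simp
  also have "\<dots> = cos t * (cos t * x $ 1 - sin t * x $ 2) + sin t * (sin t * x $ 1 + cos t * x $ 2)"
    by (simp only: algebra_simps power2_eq_square)
  finally have x1: "x $ 1 = r * cos t"
    using 1 2 by simp
  have "x $ 2 = ((sin t)\<^sup>2 + (cos t)\<^sup>2) * x $ 2"
    by simp
  also have "\<dots> = cos t * (sin t * x $ 1 + cos t * x $ 2) - sin t * (cos t * x $ 1 - sin t * x $ 2)"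
    by (simp only: algebra_simps power2_eq_square)
  finally have "x $ 2 = - (r * sin t)"
    using 1 2 by simp
  with x1 show ?thesis
    by (simp add: circle_point_def vec_eq_iff forall_2)
qed

text \<open>Negating the angle only flips the second coordinate. This allows changing the real
  representative of an angle.\<close>

lemma circle_point_uminus_cong:
  assumes "circle_point s = circle_point t"
  shows "circle_point (- s) = circle_point (- t)"
  using assms by (simp add: circle_point_def vec_eq_iff forall_2)

section \<open>Subarcs of directions avoiding the thickened lattice\<close>

text \<open>The angles are negated because \<open>k *\<^sub>R circle_point 0\<close> is turned back by \<open>t\<close>.\<close>

lemma eventually_subinterval_avoiding:
  assumes L: "additive_subgroup L" and e: "0 < e" "e < shortest_length L / 2"
    and ab: "0 \<le> a" "a < b" "b \<le> pi"
  shows "\<forall>\<^sub>F k in sequentially. \<exists>c d. a \<le> c \<and> c < d \<and> d \<le> b \<and>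
    {c..d} \<subseteq> {t. real k *\<^sub>R circle_point (- t) \<notin> L + ball 0 e}"
proof -
  define s where "s = shortest_length L"
  \<comment> \<open>Strictly interior points, so that a parameter found between them still has room
    to its right before \<open>b\<close>.\<close>
  define a' b' where "a' = (2 * a + b) / 3" and "b' = (a + 2 * b) / 3"
  have ab': "a < a'" "a' < b'" "b' < b"
    using ab by (simp_all add: a'_def b'_def field_simps)
  let ?D = "dist (circle_point (- a')) (circle_point (- b'))"
  have "?D > 0"
  proof -
    have "circle_point a' \<noteq> circle_point b'"
      using inj_onD[OF inj_on_circle_point, of a' b'] ab ab' by auto
    then show ?thesis
      using circle_point_uminus_cong[of "- a'" "- b'"] by auto
  qed
  \<comment> \<open>From this threshold on, the endpoints of the arc scaled by \<open>k\<close> are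
    at least \<open>s\<close> apart.\<close>
  then have "\<forall>\<^sub>F k in sequentially. s / ?D \<le> real k"
    using filterlim_real_sequentially by (simp add: filterlim_at_top)
  then show ?thesis
  proof eventually_elim
    case (elim k)
    define g where "g t = real k *\<^sub>R circle_point (- t)" for t
    have cont: "continuous_on S g" for S
      unfolding g_def
      by (intro continuous_intros continuous_on_compose2[OF continuous_on_circle_point[of UNIV]]) auto
    \<comment> \<open>The radius is \<open>s / 2\<close>, not \<open>e\<close>: these balls are
      still disjoint, and the slack \<open>s / 2 - e\<close> later widens a single avoiding
      parameter to an interval. One ball cannot hold the arc, because its endpoints are too far
      apart.\<close>
    have "\<not> g ` {a'..b'} \<subseteq> (\<Union>v\<in>L. ball v (s / 2))"
    proof
      assume sub: "g ` {a'..b'} \<subseteq> (\<Union>v\<in>L. ball v (s / 2))"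
      have conn: "connected (g ` {a'..b'})"
        by (intro connected_continuous_image cont) auto
      obtain v where "g ` {a'..b'} \<subseteq> ball v (s / 2)"
      proof (rule connected_subset_ball[OF conn sub])
        show "2 * (s / 2) \<le> dist v w" if "v \<in> L" "w \<in> L" "v \<noteq> w" for v w
          using shortest_length_le_dist[OF L that] by (simp add: s_def)
      qed (use ab' in auto)
      then have "dist v (g a') < s / 2" "dist v (g b') < s / 2"
        using ab' by (simp_all add: image_subset_iff)
      then have "dist (g a') (g b') < s"
        using dist_triangle3[of "g a'" "g b'" v] by simp
      moreover have "dist (g a') (g b') = real k * ?D"
        by (simp add: g_def dist_norm flip: scaleR_diff_right)
      ultimately show False
        using elim \<open>?D > 0\<close> by (simp add: field_simps)
    qed
    then obtain t where t: "t \<in> {a'..b'}" and gt: "\<And>v. v \<in> L \<Longrightarrow> s / 2 \<le> dist v (g t)"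
      by (auto simp: not_less subset_iff)
    have "isCont g t"
      using cont[of UNIV] by (simp add: continuous_on_eq_continuous_at)
    then obtain \<delta> where \<delta>: "\<delta> > 0" "\<And>t'. dist t' t < \<delta> \<Longrightarrow> dist (g t') (g t) < s / 2 - e"
      using e(2) unfolding continuous_at_eps_delta s_def by (metis diff_gt_0_iff_gt)
    \<comment> \<open>Halving \<open>\<delta>\<close> keeps the closed interval
      \<open>{t..d}\<close> within the strict continuity bound; the minimum keeps it below
      \<open>b\<close>.\<close>
    define d where "d = min b (t + \<delta> / 2)"
    have "g t' \<notin> L + ball 0 e" if "t' \<in> {t..d}" for t'
    proof
      assume "g t' \<in> L + ball 0 e"
      then obtain v where "v \<in> L" "dist v (g t') < e"
        by (auto simp: plus_ball_eq)
      moreover have "dist (g t') (g t) < s / 2 - e"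
        using that \<delta>(1) by (intro \<delta>(2)) (auto simp: dist_real_def d_def)
      ultimately show False
        using gt[of v] dist_triangle[of v "g t" "g t'"] by simp
    qed
    then show ?case
      using t ab' \<delta>(1) by (intro exI[of _ t] exI[of _ d]) (auto simp: g_def d_def)
  qed
qed

section \<open>A perfect set of directions missing points arbitrarily far out\<close>

theorem corollary5:
  fixes \<Lambda> :: "(real^2) set" and \<epsilon> :: real
  assumes "plane_lattice \<Lambda>"
    and "0 < \<epsilon>" and "\<epsilon> < shortest_length \<Lambda> / 2"
  shows "\<exists>\<Theta> \<subseteq> unit_circle. perfect_set \<Theta> \<and> \<not> good \<Lambda> \<epsilon> \<Theta>"
proof -
  let ?E = "\<Lambda> + ball 0 \<epsilon>"
  have "additive_subgroup \<Lambda>"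
    using assms(1) by (simp add: plane_lattice_def)
  note avoid = eventually_subinterval_avoiding[OF this assms(2,3)]
  obtain P where P: "P \<subseteq> {0..pi}" "perfect_set P"
    and freq: "\<exists>\<^sub>F k in sequentially. P \<subseteq> {t. real k *\<^sub>R circle_point (- t) \<notin> ?E}"
    using perfect_subset_frequently[OF pi_gt_zero avoid] by blast
  have "compact P"
    using P compact_Int_closed[of "{0..pi}" P] by (simp add: perfect_set_def Int_absorb1)
  then have "perfect_set (circle_point ` P)"
    using P continuous_on_circle_point inj_on_subset[OF inj_on_circle_point]
    by (intro perfect_set_image) auto
  moreover have "\<not> good \<Lambda> \<epsilon> (circle_point ` P)"
  proof
    assume "good \<Lambda> \<epsilon> (circle_point ` P)"
    then obtain c r where cr: "- ball c r \<subseteq> rotate_set (circle_point ` P) ?E"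
      by (auto simp: good_def)
    \<comment> \<open>By the reverse triangle inequality, points of norm at least
      \<open>norm c + r\<close> lie outside \<open>ball c r\<close>, wherever its centre is.\<close>
    obtain n where n: "norm c + r \<le> real n"
      using real_arch_simple by blast
    obtain k where "k \<ge> n" and k: "P \<subseteq> {t. real k *\<^sub>R circle_point (- t) \<notin> ?E}"
      using freq unfolding frequently_sequentially by blast
    let ?y = "real k *\<^sub>R circle_point 0"
    have "norm ?y = real k"
      using circle_point_in_unit_circle[of 0] by simp
    then have "?y \<notin> ball c r"
      using n \<open>k \<ge> n\<close> norm_triangle_ineq2[of ?y c]
      by (simp add: dist_norm norm_minus_commute del: norm_scaleR)
    then have "?y \<in> rotate_set (circle_point ` P) ?E"
      using cr by blast
    \<comment> \<open>The rotation angle \<open>t\<close> need not lie in \<open>P\<close>; it only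
      represents the same angle as some \<open>p\<close> in \<open>P\<close>.\<close>
    then obtain t x p where "?y = rotation t x" "x \<in> ?E" "p \<in> P" "circle_point t = circle_point p"
      by (auto simp: rotate_set_def)
    then have "real k *\<^sub>R circle_point (- p) \<in> ?E"
      using rotation_eqD[of t x "real k"] circle_point_uminus_cong[of t p] by simp
    with k \<open>p \<in> P\<close> show False
      by blast
  qed
  ultimately show ?thesis
    using circle_point_in_unit_circle by blast
qed

end
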